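(* Let $N,m,n\ge1$, let $F(\bm{X})=\frac12\|\bm{X}\|^2$ on $\mathscr{P}(N,\mathbb{C})$ (the function corresponding to the total square loss), and let $\bm{X}_1,\dots,\bm{X}_m$ (data) and $\bm{P}_1,\dots,\bm{P}_n$ (outliers) be matrices in $\mathscr{P}(N,\mathbb{C})$. Let $\overline{\bm{X}}$ be the TSL mean of $\bm{X}_1,\dots,\bm{X}_m$ and, for small $\varepsilon>0$, let $\widehat{\bm{X}}$ be the TSL mean of the data contaminated by the outliers with weight $\varepsilon$, and write $\widehat{\bm{X}}=\overline{\bm{X}}+\varepsilon\bm{H}+O(\varepsilon^2)$. Then $\nabla F(\bm{X})=\bm{X}$, $\frac{d}{d\varepsilon}\big|_{\varepsilon=0}\nabla F(\widehat{\bm{X}})=\bm{H}$, and the influence function of the TSL mean is $h=\|\bm{H}\|$ with $$\bm{H}=-\frac mn\left(\sum_{i=1}^m\frac1{\sqrt{1+\|\bm{X}_i\|^2}}\right)^{-1}\sum_{j=1}^n\frac{\overline{\bm{X}}-\bm{P}_j}{\sqrt{1+\|\bm{P}_j\|^2}}.$$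
   Context: $\mathscr{P}(N,\mathbb{C})$ is the set of $N\times N$ complex Hermitian positive-definite matrices; $\langle\bm{X},\bm{Y}\rangle=\operatorname{tr}(\bm{X}^{\mathrm H}\bm{Y})$ and $\|\bm{X}\|=\sqrt{\langle\bm{X},\bm{X}\rangle}$. The gradient $\nabla F(\bm{X})$ is the Hermitian matrix with $\langle\nabla F(\bm{X}),\bm{V}\rangle=\frac{d}{dt}\big|_{t=0}F(\bm{X}+t\bm{V})$ for all Hermitian $\bm{V}$. The total Bregman divergence is $\delta_F(\bm{X},\bm{Y})=\frac{F(\bm{X})-F(\bm{Y})-\langle \nabla F(\bm{Y}),\bm{X}-\bm{Y}\rangle}{\sqrt{1+\|\nabla F(\bm{Y})\|^2}}$; for the present $F$ it equals $\frac12\|\bm{X}-\bm{Y}\|^2/\sqrt{1+\|\bm{Y}\|^2}$ (total square loss, TSL). The mean $\overline{\bm{X}}$ is the minimizer over $\mathscr{P}(N,\mathbb{C})$ of $\frac1m\sum_{i=1}^m\delta_F(\bm{X},\bm{X}_i)$. The contaminated mean $\widehat{\bm{X}}=\widehat{\bm{X}}(\varepsilon)$ is the minimizer over $\mathscr{P}(N,\mathbb{C})$ of $$(1-\varepsilon)\frac1m\sum_{i=1}^m\delta_F(\bm{X},\bm{X}_i)+\varepsilon\frac1n\sum_{j=1}^n\delta_F(\bm{X},\bm{P}_j).$$ The matrix $\bm{H}=\bm{H}(\overline{\bm{X}},\bm{P}_1,\dots,\bm{P}_n)$ is the first-order coefficient in $\widehat{\bm{X}}=\overline{\bm{X}}+\varepsilon\bm{H}+O(\varepsilon^2)$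 as $\varepsilon\to0$, and the influence function is $h=\|\bm{H}\|$. *)

theory Defs
  imports "HOL-Analysis.Analysis" "HOL-Library.Landau_Symbols"
begin

definition conj_transpose :: "complex^'n^'m \<Rightarrow> complex^'m^'n" where
  "conj_transpose A = map_matrix cnj (transpose A)"

definition hermitian :: "complex^'n^'n \<Rightarrow> bool" where
  "hermitian A \<longleftrightarrow> conj_transpose A = A"

text \<open>For Hermitian \<open>A\<close> the form \<open>v\<^sup>H A v\<close> is real, so \<open>Re\<close> discards nothing here.\<close>

definition hpd :: "(complex^'n^'n) set" where
  "hpd = {A. hermitian A \<and> (\<forall>v. v \<noteq> 0 \<longrightarrow> Re (\<Sum>i\<in>UNIV. cnj (v $ i) * (A *v v) $ i) > 0)}"

definition mat_inner :: "complex^'n^'n \<Rightarrow> complex^'n^'n \<Rightarrow> complex" where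
  "mat_inner X Y = trace (conj_transpose X ** Y)"

definition mat_norm :: "complex^'n^'n \<Rightarrow> real" where
  "mat_norm X = sqrt (Re (mat_inner X X))"

text \<open>Functions on \<^term>\<open>hpd\<close> are represented by total functions on matrices. At a point of
  \<^term>\<open>hpd\<close> the gradient only sees values on \<^term>\<open>hpd\<close>, since \<^term>\<open>hpd\<close> is open
  in the real vector space of Hermitian matrices.\<close>

definition is_gradient ::
  "(complex^'n^'n \<Rightarrow> real) \<Rightarrow> complex^'n^'n \<Rightarrow> complex^'n^'n \<Rightarrow> bool" where
  "is_gradient F X G \<longleftrightarrow> hermitian G \<and>
     (\<forall>V. hermitian V \<longrightarrow>
        ((\<lambda>t::real. complex_of_real (F (X + t *\<^sub>R V)))
           has_vector_derivative mat_inner G V) (at 0))"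

definition gradient :: "(complex^'n^'n \<Rightarrow> real) \<Rightarrow> complex^'n^'n \<Rightarrow> complex^'n^'n" where
  "gradient F X = (THE G. is_gradient F X G)"

text \<open>The inner product of two Hermitian matrices is real.\<close>

definition total_bregman ::
  "(complex^'n^'n \<Rightarrow> real) \<Rightarrow> complex^'n^'n \<Rightarrow> complex^'n^'n \<Rightarrow> real" where
  "total_bregman F X Y =
     (F X - F Y - Re (mat_inner (gradient F Y) (X - Y))) / sqrt (1 + (mat_norm (gradient F Y))\<^sup>2)"

definition mean_cost ::
  "(complex^'n^'n \<Rightarrow> real) \<Rightarrow> nat \<Rightarrow> (nat \<Rightarrow> complex^'n^'n) \<Rightarrow> complex^'n^'n \<Rightarrow> real" where
  "mean_cost F m X Y = 1 / real m * (\<Sum>i = 1..m. total_bregman F Y (X i))"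

definition contaminated_cost ::
  "(complex^'n^'n \<Rightarrow> real) \<Rightarrow> nat \<Rightarrow> (nat \<Rightarrow> complex^'n^'n) \<Rightarrow>
   nat \<Rightarrow> (nat \<Rightarrow> complex^'n^'n) \<Rightarrow> real \<Rightarrow> complex^'n^'n \<Rightarrow> real" where
  "contaminated_cost F m X n P \<epsilon> Y = (1 - \<epsilon>) * mean_cost F m X Y + \<epsilon> * mean_cost F n P Y"

definition total_bregman_mean ::
  "(complex^'n^'n \<Rightarrow> real) \<Rightarrow> nat \<Rightarrow> (nat \<Rightarrow> complex^'n^'n) \<Rightarrow> complex^'n^'n" where
  "total_bregman_mean F m X = arg_min_on (mean_cost F m X) hpd"

definition contaminated_mean ::
  "(complex^'n^'n \<Rightarrow> real) \<Rightarrow> nat \<Rightarrow> (nat \<Rightarrow> complex^'n^'n) \<Rightarrow>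
   nat \<Rightarrow> (nat \<Rightarrow> complex^'n^'n) \<Rightarrow> real \<Rightarrow> complex^'n^'n" where
  "contaminated_mean F m X n P \<epsilon> = arg_min_on (contaminated_cost F m X n P \<epsilon>) hpd"

text \<open>\<open>Y \<epsilon> = Y\<^sub>0 + \<epsilon> H + O(\<epsilon>\<^sup>2)\<close> as \<open>\<epsilon> \<rightarrow> 0\<close>. The norm is taken because the Landau symbols of
  the library require values in a normed field.\<close>

definition first_order_expansion ::
  "(real \<Rightarrow> complex^'n^'n) \<Rightarrow> complex^'n^'n \<Rightarrow> complex^'n^'n \<Rightarrow> bool" where
  "first_order_expansion Y Y\<^sub>0 H \<longleftrightarrow>
     (\<lambda>\<epsilon>. mat_norm (Y \<epsilon> - (Y\<^sub>0 + \<epsilon> *\<^sub>R H))) \<in> O[at 0](\<lambda>\<epsilon>. \<epsilon>\<^sup>2)"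

definition influence_matrix ::
  "(complex^'n^'n \<Rightarrow> real) \<Rightarrow> nat \<Rightarrow> (nat \<Rightarrow> complex^'n^'n) \<Rightarrow>
   nat \<Rightarrow> (nat \<Rightarrow> complex^'n^'n) \<Rightarrow> complex^'n^'n" where
  "influence_matrix F m X n P =
     (THE H. first_order_expansion (contaminated_mean F m X n P) (total_bregman_mean F m X) H)"

definition influence_function ::
  "(complex^'n^'n \<Rightarrow> real) \<Rightarrow> nat \<Rightarrow> (nat \<Rightarrow> complex^'n^'n) \<Rightarrow>
   nat \<Rightarrow> (nat \<Rightarrow> complex^'n^'n) \<Rightarrow> real" where
  "influence_function F m X n P = mat_norm (influence_matrix F m X n P)"

end

theory Submission
  imports Defs
begin

text \<open>
  The weighted cost of the total square loss is, up to an additive constant, a positive multiple of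
  the squared distance to the weighted average of the points. The mean is therefore this average
  as soon as the average is positive definite. Merging the averages of the data and of the outliers,
  with average weights \<open>a\<close> and \<open>b\<close>, gives
  \<open>Xbar + (\<epsilon> b / ((1 - \<epsilon>) a + \<epsilon> b)) (Pbar - Xbar)\<close>, whose expansion at \<open>\<epsilon> = 0\<close> is explicit.
  Negative \<open>\<epsilon>\<close> are admissible because positive definiteness is an open condition.
\<close>

section \<open>Trace form and Hermitian matrices\<close>

lemma mat_inner_eq_sum: "mat_inner A B = (\<Sum>i\<in>UNIV. \<Sum>j\<in>UNIV. cnj (A $ i $ j) * B $ i $ j)"
proof -
  have "mat_inner A B = (\<Sum>j\<in>UNIV. \<Sum>i\<in>UNIV. cnj (A $ i $ j) * B $ i $ j)"
    by (simp add: mat_inner_def conj_transpose_def trace_def map_matrix_def transpose_def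
        matrix_matrix_mult_def)
  then show ?thesis
    using sum.swap by simp
qed

text \<open>This links the complex trace form to the Euclidean inner product of matrices regarded as
  a real vector space, so that distances can be treated in a general real inner product
  space.\<close>

lemma Re_mat_inner: "Re (mat_inner A B) = A \<bullet> B"
  by (simp add: mat_inner_eq_sum inner_vec_def inner_complex_def)

lemma mat_norm_eq_norm: "mat_norm A = norm A"
  by (simp add: mat_norm_def Re_mat_inner norm_eq_sqrt_inner)

lemma hermitian_iff: "hermitian A \<longleftrightarrow> (\<forall>i j. cnj (A $ j $ i) = A $ i $ j)"
  by (simp add: hermitian_def conj_transpose_def map_matrix_def transpose_def vec_eq_iff)

lemma hermitian_add: "hermitian A \<Longrightarrow> hermitian B \<Longrightarrow> hermitian (A + B)"
  by (simp add: hermitian_iff)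

lemma hermitian_diff: "hermitian A \<Longrightarrow> hermitian B \<Longrightarrow> hermitian (A - B)"
  by (simp add: hermitian_iff)

lemma hermitian_scaleR: "hermitian A \<Longrightarrow> hermitian (r *\<^sub>R A)"
  by (simp add: hermitian_iff)

text \<open>Conjugation exchanges the terms at (i, j) and (j, i), so the double sum equals its own
  conjugate. This reduces the complex-valued derivative in \<open>is_gradient\<close> to a real
  one.\<close>

lemma mat_inner_hermitian:
  assumes "hermitian A" "hermitian B"
  shows "mat_inner A B = complex_of_real (A \<bullet> B)"
proof -
  have "cnj (mat_inner A B) = (\<Sum>i\<in>UNIV. \<Sum>j\<in>UNIV. A $ i $ j * cnj (B $ i $ j))"
    by (simp add: mat_inner_eq_sum)
  also have "\<dots> = (\<Sum>i\<in>UNIV. \<Sum>j\<in>UNIV. cnj (A $ j $ i) * B $ j $ i)"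
    using assms by (simp add: hermitian_iff)
  also have "\<dots> = mat_inner A B"
    unfolding mat_inner_eq_sum by (rule sum.swap)
  finally have "mat_inner A B \<in> \<real>"
    by (simp add: Reals_cnj_iff)
  then show ?thesis
    by (metis Re_mat_inner of_real_Re)
qed

section \<open>The cone of positive definite matrices\<close>

lemma hpd_iff: "A \<in> hpd \<longleftrightarrow> hermitian A \<and> (\<forall>v. v \<noteq> 0 \<longrightarrow> v \<bullet> (A *v v) > 0)"
proof -
  have "Re (\<Sum>i\<in>UNIV. cnj (v $ i) * (A *v v) $ i) = v \<bullet> (A *v v)" for v
    by (simp add: inner_vec_def inner_complex_def)
  then show ?thesis
    by (simp add: hpd_def)
qed

lemma scaleR_matrix_vector_mult: "(r *\<^sub>R A) *v v = r *\<^sub>R (A *v (v :: complex^'n))"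
  by (simp add: vec_eq_iff matrix_vector_mult_def scaleR_sum_right)

lemma matrix_vector_mult_scaleR: "A *v (r *\<^sub>R v) = r *\<^sub>R (A *v (v :: complex^'n))"
  by (simp add: vec_eq_iff matrix_vector_mult_def scaleR_sum_right)

lemma hpd_add: "A \<in> hpd \<Longrightarrow> B \<in> hpd \<Longrightarrow> A + B \<in> hpd"
  by (auto simp: hpd_iff hermitian_add matrix_vector_mult_add_rdistrib inner_add_right
      intro: add_pos_pos)

lemma hpd_scaleR: "A \<in> hpd \<Longrightarrow> r > 0 \<Longrightarrow> r *\<^sub>R A \<in> hpd"
  by (simp add: hpd_iff hermitian_scaleR scaleR_matrix_vector_mult)

lemma hpd_sum:
  assumes "finite I" "I \<noteq> {}" "\<And>i. i \<in> I \<Longrightarrow> A i \<in> hpd"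
  shows "(\<Sum>i\<in>I. A i) \<in> hpd"
  using assms by (induction rule: finite_ne_induct) (auto intro: hpd_add)

lemma continuous_on_quadratic_form: "continuous_on S (\<lambda>v :: complex^'n. v \<bullet> (A *v v))"
  unfolding matrix_vector_mult_def by (intro continuous_intros)

text \<open>By compactness of the unit sphere, the form of \<open>A\<close> has a minimum
  \<open>l > 0\<close> there and the form of \<open>B\<close> is bounded by some
  \<open>K > 0\<close>; every \<open>t\<close> with |t| < l / K works. Both signs of
  \<open>t\<close> are covered, as a two-sided derivative in \<epsilon> requires.\<close>

lemma eventually_hpd_perturb:
  fixes A B :: "complex^'n^'n"
  assumes A: "A \<in> hpd" and B: "hermitian B"
  shows "\<forall>\<^sub>F t in nhds 0. A + t *\<^sub>R B \<in> hpd"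
proof -
  let ?S = "sphere 0 1 :: (complex^'n) set"
  have "axis undefined 1 \<in> ?S"
    by simp
  then have "?S \<noteq> {}"
    by blast
  then obtain u where u: "u \<in> ?S" "\<And>v. v \<in> ?S \<Longrightarrow> u \<bullet> (A *v u) \<le> v \<bullet> (A *v v)"
    using continuous_attains_inf[OF compact_sphere _ continuous_on_quadratic_form] by blast
  define l where "l = u \<bullet> (A *v u)"
  have "u \<noteq> 0"
    using u(1) by auto
  then have l: "l > 0"
    using A by (simp add: hpd_iff l_def)
  have "bounded ((\<lambda>v. v \<bullet> (B *v v)) ` ?S)"
    by (intro compact_imp_bounded compact_continuous_image continuous_on_quadratic_form
        compact_sphere)
  then obtain K where K: "K > 0" "\<And>v. v \<in> ?S \<Longrightarrow> \<bar>v \<bullet> (B *v v)\<bar> \<le> K"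
    unfolding bounded_pos by auto
  have "A + t *\<^sub>R B \<in> hpd" if t: "\<bar>t\<bar> < l / K" for t
    unfolding hpd_iff
  proof (intro conjI allI impI)
    show "hermitian (A + t *\<^sub>R B)"
      using A B by (simp add: hpd_iff hermitian_add hermitian_scaleR)
    fix v :: "complex^'n"
    assume v: "v \<noteq> 0"
    let ?q = "\<lambda>w. w \<bullet> ((A + t *\<^sub>R B) *v w)"
    define w where "w = (1 / norm v) *\<^sub>R v"
    have w: "w \<in> ?S"
      using v by (simp add: w_def)
    have "\<bar>t * (w \<bullet> (B *v w))\<bar> \<le> \<bar>t\<bar> * K"
      using K(2)[OF w] by (simp add: abs_mult mult_left_mono)
    also have "\<dots> < l"
      using t K(1) by (simp add: pos_less_divide_eq)
    finally have "0 < ?q w"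
      using u(2)[OF w] by (simp add: l_def matrix_vector_mult_add_rdistrib
          scaleR_matrix_vector_mult inner_add_right)
    \<comment> \<open>Homogeneity of degree two carries positivity from the unit vector
      \<open>w\<close> back to \<open>v\<close>.\<close>
    moreover have "?q w = (1 / norm v)\<^sup>2 * ?q v"
      by (simp only: w_def matrix_vector_mult_scaleR inner_scaleR_left inner_scaleR_right
          power2_eq_square mult.assoc)
    ultimately show "0 < ?q v"
      by (simp add: zero_less_mult_iff)
  qed
  then show ?thesis
    unfolding eventually_nhds_metric dist_real_def using l K(1)
    by (intro exI[of _ "l / K"]) auto
qed

section \<open>Gradient and divergence of half the squared norm\<close>

lemma is_gradient_unique:
  assumes "is_gradient F A G" "is_gradient F A G'"
  shows "G = G'"
proof -
  \<comment> \<open>The difference of two gradients is itself an admissible test direction.\<close>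
  have V: "hermitian (G - G')"
    using assms by (simp add: is_gradient_def hermitian_diff)
  then have "mat_inner G (G - G') = mat_inner G' (G - G')"
    using assms vector_derivative_unique_at unfolding is_gradient_def by blast
  then have "G \<bullet> (G - G') = G' \<bullet> (G - G')"
    by (metis Re_mat_inner)
  then have "(G - G') \<bullet> (G - G') = 0"
    by (simp add: inner_diff_left)
  then show ?thesis
    by simp
qed

lemma is_gradient_half_square:
  fixes A :: "complex^'n^'n"
  assumes "hermitian A"
  shows "is_gradient (\<lambda>Y. 1 / 2 * (mat_norm Y)\<^sup>2) A A"
  unfolding is_gradient_def
proof (intro conjI allI impI)
  show "hermitian A" by fact
  fix V :: "complex^'n^'n"
  assume V: "hermitian V"
  \<comment> \<open>Along a line the function is a quadratic polynomial in \<open>t\<close>; its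
    linear coefficient is the derivative at 0.\<close>
  have eq: "1 / 2 * (mat_norm (A + t *\<^sub>R V))\<^sup>2
      = 1 / 2 * (A \<bullet> A) + t * (A \<bullet> V) + t\<^sup>2 * (1 / 2 * (V \<bullet> V))" for t
    unfolding mat_norm_eq_norm power2_norm_eq_inner
    by (simp add: inner_add_left inner_add_right inner_commute power2_eq_square algebra_simps)
  have "((\<lambda>t. 1 / 2 * (mat_norm (A + t *\<^sub>R V))\<^sup>2) has_real_derivative A \<bullet> V) (at 0)"
    unfolding eq by (auto intro!: derivative_eq_intros)
  then show "((\<lambda>t. complex_of_real (1 / 2 * (mat_norm (A + t *\<^sub>R V))\<^sup>2))
      has_vector_derivative mat_inner A V) (at 0)"
    unfolding mat_inner_hermitian[OF assms V] by (rule has_vector_derivative_of_real)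
qed

lemma gradient_half_square: "hermitian A \<Longrightarrow> gradient (\<lambda>Y. 1 / 2 * (mat_norm Y)\<^sup>2) A = A"
  unfolding gradient_def using is_gradient_half_square is_gradient_unique by blast

definition tsl_weight :: "complex^'n^'n \<Rightarrow> real" where
  "tsl_weight A = 1 / sqrt (1 + (mat_norm A)\<^sup>2)"

lemma tsl_weight_pos: "tsl_weight A > 0"
  by (simp add: tsl_weight_def add_pos_nonneg)

text \<open>Since the gradient at \<open>A\<close> is \<open>A\<close>, the numerator becomes half a
  squared distance, and the denominator, depending on \<open>A\<close> only, acts as a weight
  constant in \<open>Y\<close>.\<close>

lemma total_bregman_half_square:
  assumes "hermitian A"
  shows "total_bregman (\<lambda>Y. 1 / 2 * (mat_norm Y)\<^sup>2) Y A = tsl_weight A * (norm (Y - A))\<^sup>2 / 2"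
proof -
  have "1 / 2 * (norm Y)\<^sup>2 - 1 / 2 * (norm A)\<^sup>2 - A \<bullet> (Y - A) = (norm (Y - A))\<^sup>2 / 2"
    by (simp add: power2_norm_eq_inner inner_diff_left inner_diff_right inner_commute field_simps)
  then show ?thesis
    unfolding total_bregman_def gradient_half_square[OF assms]
    unfolding mat_norm_eq_norm Re_mat_inner tsl_weight_def by (simp only:) simp
qed

section \<open>Weighted sums of squared distances and their minimizers\<close>

lemma sum_weighted_square_dist:
  fixes x :: "'i \<Rightarrow> 'a :: real_inner"
  assumes "sum w I *\<^sub>R c = (\<Sum>i\<in>I. w i *\<^sub>R x i)"
  shows "(\<Sum>i\<in>I. w i * (norm (y - x i))\<^sup>2)
    = sum w I * (norm (y - c))\<^sup>2 + ((\<Sum>i\<in>I. w i * (norm (x i))\<^sup>2) - sum w I * (norm c)\<^sup>2)"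
proof -
  have "(\<Sum>i\<in>I. w i * (norm (y - x i))\<^sup>2)
      = (\<Sum>i\<in>I. w i * (norm y)\<^sup>2 - 2 * (y \<bullet> (w i *\<^sub>R x i)) + w i * (norm (x i))\<^sup>2)"
    by (intro sum.cong refl)
      (simp add: power2_norm_eq_inner inner_diff_left inner_diff_right inner_commute algebra_simps)
  \<comment> \<open>The moment equation for \<open>c\<close> merges the mixed terms, after which the
    square is completed. The weights may have either sign, which later permits negative
    \<epsilon>.\<close>
  also have "\<dots> = sum w I * (norm y)\<^sup>2 - 2 * (y \<bullet> (sum w I *\<^sub>R c))
      + (\<Sum>i\<in>I. w i * (norm (x i))\<^sup>2)"
    unfolding assms inner_sum_right
    by (simp add: sum.distrib sum_subtractf sum_distrib_left sum_distrib_right)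
  also have "\<dots> = sum w I * (norm (y - c))\<^sup>2
      + ((\<Sum>i\<in>I. w i * (norm (x i))\<^sup>2) - sum w I * (norm c)\<^sup>2)"
    by (simp add: power2_norm_eq_inner inner_diff_left inner_diff_right inner_commute algebra_simps)
  finally show ?thesis .
qed

lemma add_weighted_square_dist:
  fixes a b :: "'a :: real_inner"
  assumes "p + q \<noteq> 0"
  shows "\<exists>k. \<forall>y. p * (norm (y - a))\<^sup>2 + q * (norm (y - b))\<^sup>2
    = (p + q) * (norm (y - (a + (q / (p + q)) *\<^sub>R (b - a))))\<^sup>2 + k"
proof -
  have "(p + q) *\<^sub>R (a + (q / (p + q)) *\<^sub>R (b - a)) = p *\<^sub>R a + q *\<^sub>R b"
    using assms by (simp add: scaleR_right_distrib) (simp add: algebra_simps)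
  then show ?thesis
    \<comment> \<open>The two points are indexed by the booleans to obtain an instance of the
      general sum.\<close>
    using sum_weighted_square_dist[of "\<lambda>i. if i then p else q" UNIV _ "\<lambda>i. if i then a else b"]
    by (auto simp: UNIV_bool add.commute)
qed

text \<open>A minimizer cannot have a larger value than \<open>c\<close>, where the square vanishes,
  so its own square vanishes too. The equivalence yields both unique existence and the value of
  \<open>arg_min_on\<close>.\<close>

lemma is_arg_min_square_dist_iff:
  fixes c :: "'a :: real_inner"
  assumes "\<And>y. f y = a * (norm (y - c))\<^sup>2 + k" "a > 0" "c \<in> S"
  shows "is_arg_min f (\<lambda>y. y \<in> S) y \<longleftrightarrow> y = c"
proof
  assume "is_arg_min f (\<lambda>y. y \<in> S) y"
  then have "f y \<le> f c"
    using assms(3) by (auto simp: is_arg_min_linorder)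
  then show "y = c"
    using assms(1,2) by (simp add: mult_le_0_iff)
qed (use assms in \<open>simp add: is_arg_min_linorder\<close>)

lemma arg_min_on_square_dist:
  fixes c :: "'a :: real_inner"
  assumes "\<And>y. f y = a * (norm (y - c))\<^sup>2 + k" "a > 0" "c \<in> S"
  shows "arg_min_on f S = c"
  unfolding arg_min_on_def arg_min_def is_arg_min_square_dist_iff[OF assms] by simp

section \<open>The weighted centre and the mean cost\<close>

definition tsl_center :: "nat \<Rightarrow> (nat \<Rightarrow> complex^'n^'n) \<Rightarrow> complex^'n^'n" where
  "tsl_center m X = inverse (\<Sum>i=1..m. tsl_weight (X i)) *\<^sub>R (\<Sum>i=1..m. tsl_weight (X i) *\<^sub>R X i)"

lemma sum_tsl_weight_pos: "m \<ge> 1 \<Longrightarrow> (\<Sum>i=1..m. tsl_weight (X i)) > 0" for m :: nat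
  by (intro sum_pos tsl_weight_pos) auto

lemma scaleR_tsl_center:
  assumes "m \<ge> 1"
  shows "(\<Sum>i=1..m. tsl_weight (X i)) *\<^sub>R tsl_center m X = (\<Sum>i=1..m. tsl_weight (X i) *\<^sub>R X i)"
  using sum_tsl_weight_pos[OF assms, of X] by (simp add: tsl_center_def)

lemma tsl_center_hpd:
  assumes "m \<ge> 1" "\<And>i. i \<in> {1..m} \<Longrightarrow> X i \<in> hpd"
  shows "tsl_center m X \<in> hpd"
  unfolding tsl_center_def
  using assms sum_tsl_weight_pos[OF assms(1), of X]
  by (intro hpd_scaleR hpd_sum) (auto simp: tsl_weight_pos)

lemma mean_cost_half_square:
  fixes X :: "nat \<Rightarrow> complex^'n^'n"
  assumes m: "m \<ge> 1" and X: "\<And>i. i \<in> {1..m} \<Longrightarrow> X i \<in> hpd"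
  shows "\<exists>k. \<forall>Y. mean_cost (\<lambda>Y. 1 / 2 * (mat_norm Y)\<^sup>2) m X Y
    = (\<Sum>i=1..m. tsl_weight (X i)) / (2 * real m) * (norm (Y - tsl_center m X))\<^sup>2 + k"
proof -
  let ?W = "\<Sum>i=1..m. tsl_weight (X i)"
  \<comment> \<open>The part of the weighted sum of squares that is independent of \<open>Y\<close>
    and so cannot affect the minimizer.\<close>
  define k where "k = (\<Sum>i=1..m. tsl_weight (X i) * (norm (X i))\<^sup>2) - ?W * (norm (tsl_center m X))\<^sup>2"
  have "mean_cost (\<lambda>Y. 1 / 2 * (mat_norm Y)\<^sup>2) m X Y
      = ?W / (2 * real m) * (norm (Y - tsl_center m X))\<^sup>2 + k / (2 * real m)" for Y
  proof -
    have "(\<Sum>i=1..m. total_bregman (\<lambda>Y. 1 / 2 * (mat_norm Y)\<^sup>2) Y (X i))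
        = (\<Sum>i=1..m. tsl_weight (X i) * (norm (Y - X i))\<^sup>2 / 2)"
    proof (rule sum.cong)
      fix i
      assume "i \<in> {1..m}"
      then have "hermitian (X i)"
        using X by (simp add: hpd_iff)
      then show "total_bregman (\<lambda>Y. 1 / 2 * (mat_norm Y)\<^sup>2) Y (X i)
          = tsl_weight (X i) * (norm (Y - X i))\<^sup>2 / 2"
        by (rule total_bregman_half_square)
    qed simp
    also have "\<dots> = (?W * (norm (Y - tsl_center m X))\<^sup>2 + k) / 2"
      unfolding k_def sum_divide_distrib[symmetric]
      by (subst sum_weighted_square_dist[OF scaleR_tsl_center[OF m]]) simp
    finally show ?thesis
      unfolding mean_cost_def using m by (simp add: field_simps)
  qed
  then show ?thesis
    by blast
qed

section \<open>First-order expansions and derivatives\<close>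

lemma first_order_expansion_has_vector_derivative:
  fixes Y :: "real \<Rightarrow> complex^'n^'n"
  assumes "first_order_expansion Y Y0 H" "Y 0 = Y0"
  shows "(Y has_vector_derivative H) (at 0)"
proof -
  have "(\<lambda>\<epsilon>. norm (Y \<epsilon> - (Y0 + \<epsilon> *\<^sub>R H))) \<in> O[at 0](\<lambda>\<epsilon>. \<epsilon>\<^sup>2)"
    using assms(1) by (simp add: first_order_expansion_def mat_norm_eq_norm)
  \<comment> \<open>A remainder of order \<epsilon>^2 is o(\<epsilon>), which is differentiability
    at 0 once \<open>Y 0 = Y0\<close> fixes the value that an expansion along \<open>at 0\<close>
    does not see.\<close>
  also have "(\<lambda>\<epsilon>::real. \<epsilon>\<^sup>2) \<in> o[at 0](\<lambda>\<epsilon>. \<epsilon>)"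
    by (intro smalloI_tendsto) (auto simp: power2_eq_square eventually_at_filter)
  finally have "((\<lambda>\<epsilon>. norm (Y \<epsilon> - (Y0 + \<epsilon> *\<^sub>R H)) / \<epsilon>) \<longlongrightarrow> 0) (at 0)"
    by (rule smalloD_tendsto)
  \<comment> \<open>\<open>has_derivative_at\<close> divides by the norm of the increment, so the
    sign of \<epsilon> has to be removed.\<close>
  then have "((\<lambda>\<epsilon>. \<bar>norm (Y \<epsilon> - (Y0 + \<epsilon> *\<^sub>R H)) / \<epsilon>\<bar>) \<longlongrightarrow> 0) (at 0)"
    by (rule tendsto_rabs_zero)
  then show ?thesis
    unfolding has_vector_derivative_def has_derivative_at
    using assms(2) by (simp add: bounded_linear_scaleR_left abs_divide algebra_simps)
qed

text \<open>The expansion says nothing about \<open>Y 0\<close>. Redefining this value as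
  \<open>Y0\<close> keeps the expansion and makes both coefficients derivatives of one function at
  0.\<close>

lemma first_order_expansion_unique:
  assumes "first_order_expansion Y Y0 H" "first_order_expansion Y Y0 H'"
  shows "H = H'"
proof -
  define Z where "Z = Y(0 := Y0)"
  have ev: "\<forall>\<^sub>F \<epsilon> in at 0. Y \<epsilon> = Z \<epsilon>"
    by (simp add: Z_def eventually_at_filter)
  have "(Z has_vector_derivative K) (at 0)" if "first_order_expansion Y Y0 K" for K
  proof (rule first_order_expansion_has_vector_derivative)
    have "(\<lambda>\<epsilon>. mat_norm (Y \<epsilon> - (Y0 + \<epsilon> *\<^sub>R K))) \<in> O[at 0](\<lambda>\<epsilon>. \<epsilon>\<^sup>2)
        \<longleftrightarrow> (\<lambda>\<epsilon>. mat_norm (Z \<epsilon> - (Y0 + \<epsilon> *\<^sub>R K))) \<in> O[at 0](\<lambda>\<epsilon>. \<epsilon>\<^sup>2)"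
      by (rule landau_o.big.in_cong) (use ev in \<open>auto elim: eventually_mono\<close>)
    then show "first_order_expansion Z Y0 K"
      using that by (simp add: first_order_expansion_def)
  qed (simp add: Z_def)
  then show ?thesis
    using assms vector_derivative_unique_at by blast
qed

theorem proposition11:
  fixes F :: "complex^'N^'N \<Rightarrow> real"
    and m n :: nat
    and X P :: "nat \<Rightarrow> complex^'N^'N"
    and Xbar H :: "complex^'N^'N"
    and Xhat :: "real \<Rightarrow> complex^'N^'N"
  assumes "m \<ge> 1" and "n \<ge> 1"
    and "\<And>i. i \<in> {1..m} \<Longrightarrow> X i \<in> hpd"
    and "\<And>j. j \<in> {1..n} \<Longrightarrow> P j \<in> hpd"
    and "F = (\<lambda>Y. 1 / 2 * (mat_norm Y)\<^sup>2)"
    and "Xbar = total_bregman_mean F m X"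
    and "Xhat = contaminated_mean F m X n P"
    and "H = influence_matrix F m X n P"
  shows "(\<exists>!Y. is_arg_min (mean_cost F m X) (\<lambda>Y. Y \<in> hpd) Y) \<and>
         (\<forall>\<^sub>F \<epsilon> in nhds 0. \<exists>!Y. is_arg_min (contaminated_cost F m X n P \<epsilon>) (\<lambda>Y. Y \<in> hpd) Y) \<and>
         first_order_expansion Xhat Xbar H \<and>
         (\<forall>Y \<in> hpd. is_gradient F Y Y \<and> gradient F Y = Y) \<and>
         ((\<lambda>\<epsilon>. gradient F (Xhat \<epsilon>)) has_vector_derivative H) (at 0) \<and>
         influence_function F m X n P = mat_norm H \<and>
         (H = - (real m / real n * inverse (\<Sum>i = 1..m. 1 / sqrt (1 + (mat_norm (X i))\<^sup>2))) *\<^sub>R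
              (\<Sum>j = 1..n. (1 / sqrt (1 + (mat_norm (P j))\<^sup>2)) *\<^sub>R (Xbar - P j)))"
proof -
  note defs = assms(5-8)
  have m: "real m > 0" and n: "real n > 0"
    using assms(1,2) by auto
  define W V where "W = (\<Sum>i=1..m. tsl_weight (X i))" and "V = (\<Sum>j=1..n. tsl_weight (P j))"
  define C D where "C = tsl_center m X" and "D = tsl_center n P"
  have C: "C \<in> hpd" and D: "D \<in> hpd"
    using assms(1-4) by (auto simp: C_def D_def intro!: tsl_center_hpd)
  \<comment> \<open>\<open>a / 2\<close> and \<open>b / 2\<close> will be the coefficients of the
    squared distances to \<open>C\<close> and \<open>D\<close> in the two mean costs.\<close>
  define a b where "a = W / m" and "b = V / n"
  have a: "a > 0"
    using sum_tsl_weight_pos[OF assms(1), of X] m by (simp add: a_def W_def)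
  obtain k where k: "\<And>Y. mean_cost F m X Y = a / 2 * (norm (Y - C))\<^sup>2 + k"
    using mean_cost_half_square[of m X] assms(1,3)
    by (auto simp: assms(5) a_def W_def C_def mult.commute)
  obtain l where l: "\<And>Y. mean_cost F n P Y = b / 2 * (norm (Y - D))\<^sup>2 + l"
    using mean_cost_half_square[of n P] assms(2,4)
    by (auto simp: assms(5) b_def V_def D_def mult.commute)

  \<comment> \<open>At contamination \<epsilon>, \<open>s\<close> is the total weight,
    \<open>r\<close> the share of the outliers in it, and \<open>Q\<close> the resulting centre on
    the line through \<open>C\<close> and \<open>D\<close>.\<close>
  define s where "s \<epsilon> = (1 - \<epsilon>) * a + \<epsilon> * b" for \<epsilon>
  define r where "r \<epsilon> = \<epsilon> * b / s \<epsilon>" for \<epsilon>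
  define Q where "Q \<epsilon> = C + r \<epsilon> *\<^sub>R (D - C)" for \<epsilon>
  have s_lim: "(s \<longlongrightarrow> a) (nhds 0)"
    unfolding s_def by (auto intro!: tendsto_eq_intros filterlim_ident)
  have s_ev: "\<forall>\<^sub>F \<epsilon> in nhds 0. s \<epsilon> > 0"
    using order_tendstoD(1)[OF s_lim a] .
  \<comment> \<open>The limit along \<open>nhds 0\<close> includes the point 0 itself;
    \<open>Q\<close> then stays in the cone on both sides of 0 by the perturbation lemma.\<close>
  have "(r \<longlongrightarrow> 0) (nhds 0)"
    unfolding r_def using a by (auto intro!: tendsto_eq_intros s_lim filterlim_ident)
  then have Q_ev: "\<forall>\<^sub>F \<epsilon> in nhds 0. Q \<epsilon> \<in> hpd"
    unfolding Q_def using eventually_hpd_perturb[OF C, of "D - C"] C D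
    by (auto simp: hpd_iff hermitian_diff dest: eventually_compose_filterlim)

  have cost: "\<exists>c. \<forall>Y. contaminated_cost F m X n P \<epsilon> Y = s \<epsilon> / 2 * (norm (Y - Q \<epsilon>))\<^sup>2 + c"
    if pos: "s \<epsilon> > 0" for \<epsilon>
  proof -
    have s: "s \<epsilon> / 2 = (1 - \<epsilon>) * a / 2 + \<epsilon> * b / 2"
      by (simp add: s_def)
    have "r \<epsilon> = (\<epsilon> * b / 2) / (s \<epsilon> / 2)"
      by (simp add: r_def)
    then obtain c where c: "\<And>Y. (1 - \<epsilon>) * a / 2 * (norm (Y - C))\<^sup>2
        + \<epsilon> * b / 2 * (norm (Y - D))\<^sup>2 = s \<epsilon> / 2 * (norm (Y - Q \<epsilon>))\<^sup>2 + c"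
      using add_weighted_square_dist[of "(1 - \<epsilon>) * a / 2" "\<epsilon> * b / 2" C D] pos
      unfolding Q_def s[symmetric] by auto
    have "contaminated_cost F m X n P \<epsilon> Y
        = s \<epsilon> / 2 * (norm (Y - Q \<epsilon>))\<^sup>2 + (c + (1 - \<epsilon>) * k + \<epsilon> * l)" for Y
      using c[of Y] unfolding contaminated_cost_def k l by (simp add: algebra_simps)
    then show ?thesis
      by blast
  qed

  have min_mean: "\<exists>!Y. is_arg_min (mean_cost F m X) (\<lambda>Y. Y \<in> hpd) Y"
    using is_arg_min_square_dist_iff[OF k _ C] a by simp
  have Xbar: "Xbar = C"
    unfolding defs(2) total_bregman_mean_def using a arg_min_on_square_dist[OF k _ C] by simp
  have min_cont: "\<forall>\<^sub>F \<epsilon> in nhds 0. \<exists>!Y. is_arg_min (contaminated_cost F m X n P \<epsilon>) (\<lambda>Y. Y \<in> hpd) Y"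
    using s_ev Q_ev
  proof eventually_elim
    case (elim \<epsilon>)
    obtain c where c: "\<And>Y. contaminated_cost F m X n P \<epsilon> Y = s \<epsilon> / 2 * (norm (Y - Q \<epsilon>))\<^sup>2 + c"
      using cost[OF elim(1)] by blast
    show ?case
      using is_arg_min_square_dist_iff[OF c _ elim(2)] elim(1) by simp
  qed
  have Xhat: "\<forall>\<^sub>F \<epsilon> in nhds 0. Xhat \<epsilon> = Q \<epsilon>"
    using s_ev Q_ev
  proof eventually_elim
    case (elim \<epsilon>)
    obtain c where c: "\<And>Y. contaminated_cost F m X n P \<epsilon> Y = s \<epsilon> / 2 * (norm (Y - Q \<epsilon>))\<^sup>2 + c"
      using cost[OF elim(1)] by blast
    show ?case
      unfolding defs(3) contaminated_mean_def
      using arg_min_on_square_dist[OF c _ elim(2)] elim(1) by simp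
  qed

  have at_0: "\<forall>\<^sub>F \<epsilon> in at 0. p \<epsilon>" if "\<forall>\<^sub>F \<epsilon> in nhds 0. p \<epsilon>" for p :: "real \<Rightarrow> bool"
    using that by (auto simp: eventually_at_filter elim: eventually_mono)
  \<comment> \<open>Since \<open>s 0 = a\<close>, the derivative of \<open>r\<close> at 0 is
    \<open>b / a\<close>, which gives the candidate for the coefficient.\<close>
  define K where "K = (b / a) *\<^sub>R (D - C)"
  have "(\<lambda>\<epsilon>. mat_norm (Xhat \<epsilon> - (Xbar + \<epsilon> *\<^sub>R K))) \<in> O[at 0](\<lambda>\<epsilon>. \<epsilon>\<^sup>2)"
  proof -
    have "\<forall>\<^sub>F \<epsilon> in at 0. mat_norm (Xhat \<epsilon> - (Xbar + \<epsilon> *\<^sub>R K))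
        = \<epsilon>\<^sup>2 * (\<bar>b * (a - b) / (a * s \<epsilon>)\<bar> * norm (D - C))"
      using at_0[OF Xhat] at_0[OF s_ev]
    proof eventually_elim
      case (elim \<epsilon>)
      \<comment> \<open>Over the common denominator \<open>a * s \<epsilon>\<close> the factor
        \<open>a - s \<epsilon> = \<epsilon> * (a - b)\<close> appears, which supplies the second
        power of \<epsilon>.\<close>
      have "r \<epsilon> - \<epsilon> * (b / a) = \<epsilon>\<^sup>2 * (b * (a - b) / (a * s \<epsilon>))"
        using a elim(2) by (simp add: r_def field_simps power2_eq_square) (simp add: s_def algebra_simps)
      moreover have "Xhat \<epsilon> - (Xbar + \<epsilon> *\<^sub>R K) = (r \<epsilon> - \<epsilon> * (b / a)) *\<^sub>R (D - C)"
        by (simp add: elim(1) Xbar Q_def K_def scaleR_left_diff_distrib)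
      ultimately show ?case
        by (simp add: mat_norm_eq_norm abs_mult)
    qed
    moreover have "(\<lambda>\<epsilon>. \<epsilon>\<^sup>2 * (\<bar>b * (a - b) / (a * s \<epsilon>)\<bar> * norm (D - C))) \<in> O[at 0](\<lambda>\<epsilon>. \<epsilon>\<^sup>2 * 1)"
    proof (intro landau_o.big.mult landau_o.big_refl)
      have s_at: "(s \<longlongrightarrow> a) (at 0)"
        using s_lim by (rule filterlim_mono) (auto simp: at_within_def)
      \<comment> \<open>The factor beside \<epsilon>^2 converges because \<open>s\<close> tends to
        \<open>a > 0\<close>, hence it is O(1).\<close>
      have "((\<lambda>\<epsilon>. \<bar>b * (a - b) / (a * s \<epsilon>)\<bar> * norm (D - C))
          \<longlongrightarrow> \<bar>b * (a - b) / (a * a)\<bar> * norm (D - C)) (at 0)"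
        using a by (intro tendsto_intros s_at) simp
      then show "(\<lambda>\<epsilon>. \<bar>b * (a - b) / (a * s \<epsilon>)\<bar> * norm (D - C)) \<in> O[at 0](\<lambda>_. 1)"
        by (intro bigoI_tendsto[where c = "\<bar>b * (a - b) / (a * a)\<bar> * norm (D - C)"]) auto
    qed
    ultimately show ?thesis
      by (simp add: landau_o.big.in_cong)
  qed
  then have exp_K: "first_order_expansion Xhat Xbar K"
    by (simp add: first_order_expansion_def)
  \<comment> \<open>Existence of the expansion and uniqueness of its coefficient resolve the
    definite description in \<open>influence_matrix\<close>.\<close>
  have H: "H = K"
    unfolding defs(4) influence_matrix_def
    using exp_K first_order_expansion_unique unfolding defs(2,3) by blast

  have grad: "\<forall>Y\<in>hpd. is_gradient F Y Y \<and> gradient F Y = Y"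
    by (auto simp: assms(5) hpd_iff simp del: times_divide_eq_left
        intro: is_gradient_half_square gradient_half_square)
  have Xhat0: "Xhat 0 = Xbar"
    using eventually_nhds_x_imp_x[OF Xhat] by (simp add: Xbar Q_def r_def)
  \<comment> \<open>Close to 0 the contaminated mean lies in the cone, where the gradient is the
    identity map, so both functions have the same derivative at 0.\<close>
  have "\<forall>\<^sub>F \<epsilon> in nhds 0. Xhat \<epsilon> = gradient F (Xhat \<epsilon>)"
    using Xhat Q_ev by eventually_elim (use grad in simp)
  then have deriv: "((\<lambda>\<epsilon>. gradient F (Xhat \<epsilon>)) has_vector_derivative H) (at 0)"
    using first_order_expansion_has_vector_derivative[OF exp_K Xhat0] eventually_nhds_x_imp_x
    unfolding H by (subst (asm) has_vector_derivative_cong_ev[where g = "\<lambda>\<epsilon>. gradient F (Xhat \<epsilon>)"])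
      (auto elim: eventually_mono)

  \<comment> \<open>The weighted outliers sum to \<open>V\<close> times \<open>D\<close>, and
    \<open>b / a\<close> is \<open>m / n\<close> times \<open>V / W\<close>; together these bring
    \<open>K\<close> into the stated form with its minus sign.\<close>
  have sum_P: "(\<Sum>j=1..n. tsl_weight (P j) *\<^sub>R (C - P j)) = V *\<^sub>R C - V *\<^sub>R D"
    unfolding V_def D_def scaleR_tsl_center[OF assms(2)]
    by (simp add: scaleR_right_diff_distrib sum_subtractf scaleR_sum_left)
  have formula: "K = - (real m / real n * inverse W) *\<^sub>R
      (\<Sum>j=1..n. tsl_weight (P j) *\<^sub>R (C - P j))"
    unfolding sum_P by (simp add: K_def a_def b_def divide_inverse algebra_simps)
  show ?thesis
    using min_mean min_cont exp_K grad deriv formula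
    unfolding influence_function_def defs(4)[symmetric] H Xbar W_def tsl_weight_def by blast
qed

end
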